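(* The proof system $\mathcal{M}$ is not complete, even for numerically explicit sets of premises: there exist a numerically explicit finite set $\Phi$ of $\mathcal{N}^{1+}$-formulas and an $\mathcal{N}^{1+}$-formula $\phi$ such that $\Phi \models \phi$ but $\Phi \not\vdash_{\mathcal{M}} \phi$.
   Context: We work in first-order logic with counting quantifiers $\exists_{\leq C}$, $\exists_{\geq C}$ with the obvious semantics; $\models$ denotes semantic entailment. A literal $L$ is a formula $p(x)$ or $\neg p(x)$ with $p$ a unary predicate; $\bar{L}$ denotes its opposite ($\neg p(x)$, resp. $p(x)$). $\mathcal{N}^{1+}$ is the set of formulas $\exists_{\geq C} x (L_1 \wedge L_2)$ and $\exists_{\leq C} x (L_1 \wedge L_2)$ with $L_1, L_2$ literals and $C \geq 0$. In the proof system, $\exists_{\bowtie C} x(L_1 \wedge L_2)$ and $\exists_{\bowtie C} x(L_2 \wedge L_1)$ are identified, and negative subscripts are allowed: for $C<0$, $\exists_{\leq C} x(L_1\wedge L_2)$ is false and $\exists_{\geq C} x(L_1\wedge L_2)$ is true. The natural deduction system $\mathcal{M}$ has: (i) axiom schemas $\exists_{\geq 0} x (L_1 \wedge L_2)$ and $\exists_{\leq C} x (L \wedge \bar{L})$ for all $C \geq 0$; (ii) rules of inference: from $\exists_{\leq C} x (L_1 \wedge L_2)$ and $\exists_{\leq D} x (\bar{L}_2 \wedge L_3)$ infer $\exists_{\leq C+D} x (L_1 \wedge L_3)$; from $\exists_{\geq C} x (L_1 \wedge L_2)$ and $\exists_{\leq D} x (L_2 \wedge L_3)$ infer $\exists_{\geq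 C-D} x (L_1 \wedge \bar{L}_3)$; from $\exists_{\leq C} x (L_1 \wedge L_1)$ and $\exists_{\geq D} x (L_1 \wedge L_2)$ infer $\exists_{\leq C-D} x (L_1 \wedge \bar{L}_2)$; (iii) ex falso quodlibet: if from premises $\Phi$ one has derived $\exists_{\leq C} x (L_1 \wedge L_2)$ and $\exists_{\geq D} x (L_1 \wedge L_2)$ with $D > C$, then any formula may be derived from $\Phi$. $\Phi \vdash_{\mathcal{M}} \phi$ means there is a deduction in $\mathcal{M}$ from premises $\Phi$ to $\phi$. A set $\Phi$ of $\mathcal{N}^{1+}$-formulas, with predicates $p_1,\ldots,p_n$, is numerically explicit if there are natural numbers $C > 0$ and $C_1,\ldots,C_n \leq C$ such that for each $i$, $\Phi$ contains $\exists_{\leq C_i} x (p_i(x) \wedge p_i(x))$, $\exists_{\geq C_i} x (p_i(x) \wedge p_i(x))$, $\exists_{\leq C - C_i} x (\neg p_i(x) \wedge \neg p_i(x))$ and $\exists_{\geq C - C_i} x (\neg p_i(x) \wedge \neg p_i(x))$. *)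

theory Defs
  imports Main "HOL-Library.Uprod" "HOL-Library.Countable_Set"
begin

text \<open>Unary predicate symbols are drawn from the countably infinite supply \<^typ>\<open>nat\<close>.\<close>

datatype literal = Pos nat | Neg nat

fun opp :: "literal \<Rightarrow> literal" where
  "opp (Pos p) = Neg p"
| "opp (Neg p) = Pos p"

fun lit_pred :: "literal \<Rightarrow> nat" where
  "lit_pred (Pos p) = p"
| "lit_pred (Neg p) = p"

text \<open>
  The matrix \<open>L\<^sub>1 \<and> L\<^sub>2\<close> is an unordered pair (with \<open>L\<^sub>1 = L\<^sub>2\<close> allowed), so that
  \<open>L\<^sub>1 \<and> L\<^sub>2\<close> and \<open>L\<^sub>2 \<and> L\<^sub>1\<close> are the same formula. Subscripts are integers because
  deductions may pass through negative subscripts; \<open>N1plus\<close> below is the fragment with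
  non-negative subscripts.
\<close>

datatype formula = AtMost int "literal uprod" | AtLeast int "literal uprod"

abbreviation ex_le :: "int \<Rightarrow> literal \<Rightarrow> literal \<Rightarrow> formula" where
  "ex_le C L\<^sub>1 L\<^sub>2 \<equiv> AtMost C (Upair L\<^sub>1 L\<^sub>2)"

abbreviation ex_ge :: "int \<Rightarrow> literal \<Rightarrow> literal \<Rightarrow> formula" where
  "ex_ge C L\<^sub>1 L\<^sub>2 \<equiv> AtLeast C (Upair L\<^sub>1 L\<^sub>2)"

definition N1plus :: "formula set" where
  "N1plus = {ex_le C L\<^sub>1 L\<^sub>2 | C L\<^sub>1 L\<^sub>2. C \<ge> 0} \<union> {ex_ge C L\<^sub>1 L\<^sub>2 | C L\<^sub>1 L\<^sub>2. C \<ge> 0}"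

fun formula_preds :: "formula \<Rightarrow> nat set" where
  "formula_preds (AtMost C M) = lit_pred ` set_uprod M"
| "formula_preds (AtLeast C M) = lit_pred ` set_uprod M"

definition preds :: "formula set \<Rightarrow> nat set" where
  "preds \<Phi> = (\<Union>\<phi>\<in>\<Phi>. formula_preds \<phi>)"

text \<open>A structure is a non-empty domain \<open>D\<close> with an interpretation \<open>I\<close> of the predicates.\<close>

fun lit_true :: "(nat \<Rightarrow> 'a set) \<Rightarrow> 'a \<Rightarrow> literal \<Rightarrow> bool" where
  "lit_true I x (Pos p) \<longleftrightarrow> x \<in> I p"
| "lit_true I x (Neg p) \<longleftrightarrow> x \<notin> I p"

definition ext :: "'a set \<Rightarrow> (nat \<Rightarrow> 'a set) \<Rightarrow> literal uprod \<Rightarrow> 'a set" where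
  "ext D I M = {x \<in> D. \<forall>L \<in> set_uprod M. lit_true I x L}"

text \<open>
  For \<open>C < 0\<close> these clauses make \<open>AtMost C M\<close> false and \<open>AtLeast C M\<close> true.
\<close>

fun sat :: "'a set \<Rightarrow> (nat \<Rightarrow> 'a set) \<Rightarrow> formula \<Rightarrow> bool" where
  "sat D I (AtMost C M) \<longleftrightarrow> finite (ext D I M) \<and> int (card (ext D I M)) \<le> C"
| "sat D I (AtLeast C M) \<longleftrightarrow> infinite (ext D I M) \<or> C \<le> int (card (ext D I M))"

text \<open>
  HOL cannot quantify over all types inside a definition, so the domains are the non-empty sets
  of natural numbers. By \<open>entails_any_domain\<close> below, this is the same as entailment over
  structures of arbitrary type.
\<close>

definition entails :: "formula set \<Rightarrow> formula \<Rightarrow> bool"  (infix "\<TTurnstile>" 50) where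
  "\<Phi> \<TTurnstile> \<phi> \<longleftrightarrow>
    (\<forall>(D :: nat set) I. D \<noteq> {} \<longrightarrow> (\<forall>\<psi>\<in>\<Phi>. sat D I \<psi>) \<longrightarrow> sat D I \<phi>)"

inductive deduces :: "formula set \<Rightarrow> formula \<Rightarrow> bool"  (infix "\<turnstile>\<^sub>M" 50)
  for \<Phi> :: "formula set" where
  premise: "\<phi> \<in> \<Phi> \<Longrightarrow> \<Phi> \<turnstile>\<^sub>M \<phi>"
| axiom_ge: "\<Phi> \<turnstile>\<^sub>M ex_ge 0 L\<^sub>1 L\<^sub>2"
| axiom_le: "C \<ge> 0 \<Longrightarrow> \<Phi> \<turnstile>\<^sub>M ex_le C L (opp L)"
| rule_le_le:
    "\<Phi> \<turnstile>\<^sub>M ex_le C L\<^sub>1 L\<^sub>2 \<Longrightarrow> \<Phi> \<turnstile>\<^sub>M ex_le D (opp L\<^sub>2) L\<^sub>3 \<Longrightarrow> \<Phi> \<turnstile>\<^sub>M ex_le (C + D) L\<^sub>1 L\<^sub>3"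
| rule_ge_le:
    "\<Phi> \<turnstile>\<^sub>M ex_ge C L\<^sub>1 L\<^sub>2 \<Longrightarrow> \<Phi> \<turnstile>\<^sub>M ex_le D L\<^sub>2 L\<^sub>3 \<Longrightarrow> \<Phi> \<turnstile>\<^sub>M ex_ge (C - D) L\<^sub>1 (opp L\<^sub>3)"
| rule_le_ge:
    "\<Phi> \<turnstile>\<^sub>M ex_le C L\<^sub>1 L\<^sub>1 \<Longrightarrow> \<Phi> \<turnstile>\<^sub>M ex_ge D L\<^sub>1 L\<^sub>2 \<Longrightarrow> \<Phi> \<turnstile>\<^sub>M ex_le (C - D) L\<^sub>1 (opp L\<^sub>2)"
| ex_falso:
    "\<Phi> \<turnstile>\<^sub>M ex_le C L\<^sub>1 L\<^sub>2 \<Longrightarrow> \<Phi> \<turnstile>\<^sub>M ex_ge D L\<^sub>1 L\<^sub>2 \<Longrightarrow> D > C \<Longrightarrow> \<Phi> \<turnstile>\<^sub>M \<phi>"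

definition numerically_explicit :: "formula set \<Rightarrow> bool" where
  "numerically_explicit \<Phi> \<longleftrightarrow>
    \<Phi> \<subseteq> N1plus \<and>
    (\<exists>(C :: nat) (c :: nat \<Rightarrow> nat). C > 0 \<and>
      (\<forall>p \<in> preds \<Phi>. c p \<le> C \<and>
        ex_le (int (c p)) (Pos p) (Pos p) \<in> \<Phi> \<and>
        ex_ge (int (c p)) (Pos p) (Pos p) \<in> \<Phi> \<and>
        ex_le (int C - int (c p)) (Neg p) (Neg p) \<in> \<Phi> \<and>
        ex_ge (int C - int (c p)) (Neg p) (Neg p) \<in> \<Phi>))"

instance literal :: countable
  by countable_datatype

lemma sat_bij:
  assumes "bij_betw f D E"
  shows "sat E (\<lambda>p. f ` (I p \<inter> D)) \<phi> \<longleftrightarrow> sat D I \<phi>"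
proof -
  have inj: "inj_on f D" and E: "E = f ` D"
    using assms by (auto simp: bij_betw_def)
  have lit: "lit_true (\<lambda>p. f ` (I p \<inter> D)) (f x) L \<longleftrightarrow> lit_true I x L" if "x \<in> D" for x L
    using that inj by (cases L) (auto dest: inj_onD)
  have ext: "ext E (\<lambda>p. f ` (I p \<inter> D)) M = f ` ext D I M" for M
    unfolding ext_def E using lit by auto
  have inj': "inj_on f (ext D I M)" for M
    using inj by (rule inj_on_subset) (auto simp: ext_def)
  show ?thesis
    by (cases \<phi>) (simp_all add: ext finite_image_iff[OF inj'] card_image[OF inj'])
qed

lemma countable_substructure:
  fixes D :: "'a set"
  assumes "D \<noteq> {}"
  obtains E where "E \<subseteq> D" "E \<noteq> {}" "countable E" "\<And>\<phi>. sat E I \<phi> \<longleftrightarrow> sat D I \<phi>"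
proof -
  let ?X = "ext D I"
  have "\<exists>S. S \<subseteq> ?X M \<and> countable S \<and> (finite (?X M) \<longrightarrow> S = ?X M) \<and>
          (infinite (?X M) \<longrightarrow> infinite S)" for M
    using infinite_countable_subset'[of "?X M"] uncountable_infinite countable_finite
    by (metis order_refl)
  then obtain S where S: "\<And>M. S M \<subseteq> ?X M" "\<And>M. countable (S M)"
    "\<And>M. finite (?X M) \<Longrightarrow> S M = ?X M" "\<And>M. infinite (?X M) \<Longrightarrow> infinite (S M)"
    by metis
  define E where "E = (\<Union>L\<^sub>1. \<Union>L\<^sub>2. S (Upair L\<^sub>1 L\<^sub>2))"
  have sub: "E \<subseteq> D"
    using S(1) by (fastforce simp: E_def ext_def)
  have SE: "S M \<subseteq> ext E I M" for M
  proof -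
    obtain L\<^sub>1 L\<^sub>2 where M: "M = Upair L\<^sub>1 L\<^sub>2" by (cases M) auto
    then have "S M \<subseteq> E" by (auto simp: E_def)
    then show ?thesis using S(1)[of M] by (auto simp: ext_def)
  qed
  have EX: "ext E I M \<subseteq> ?X M" for M
    using sub by (auto simp: ext_def)
  have fin: "finite (?X M) \<Longrightarrow> ext E I M = ?X M" for M
    using S(3)[of M] SE[of M] EX[of M] by auto
  have inf: "infinite (?X M) \<Longrightarrow> infinite (ext E I M)" for M
    using S(4)[of M] SE[of M] finite_subset by blast
  have sat: "sat E I \<phi> \<longleftrightarrow> sat D I \<phi>" for \<phi>
    using fin inf by (cases \<phi>) (simp, metis)+
  obtain x where x: "x \<in> D" using assms by auto
  obtain L where "lit_true I x L"
    by (metis lit_true.simps)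
  then have "x \<in> ?X (Upair L L)" using x by (auto simp: ext_def)
  then have "S (Upair L L) \<noteq> {}"
    using S(3,4)[of "Upair L L"] by (metis empty_iff finite.emptyI)
  then have "E \<noteq> {}" by (auto simp: E_def)
  moreover have "countable E"
    unfolding E_def using S(2) by auto
  ultimately show thesis using that sub sat by blast
qed

lemma entails_any_domain:
  fixes D :: "'a set"
  assumes "\<Phi> \<TTurnstile> \<phi>" "D \<noteq> {}" "\<forall>\<psi>\<in>\<Phi>. sat D I \<psi>"
  shows "sat D I \<phi>"
proof -
  obtain E where E: "E \<noteq> {}" "countable E" "\<And>\<phi>. sat E I \<phi> \<longleftrightarrow> sat D I \<phi>"
    using countable_substructure[OF assms(2)] by metis
  obtain f :: "'a \<Rightarrow> nat" where "inj_on f E"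
    using E(2) by (auto simp: countable_def)
  then have "bij_betw f E (f ` E)" by (simp add: bij_betw_def)
  from sat_bij[OF this] show ?thesis
    using assms E unfolding entails_def by (metis image_is_empty)
qed

end

theory Submission imports Defs begin

text \<open>
  Three pairwise disjoint singletons do not fit into a set with two elements, so premises that
  describe such a configuration by the sizes of its pairwise intersections are unsatisfiable and
  entail everything. Every rule of \<open>\<M>\<close> mentions at most three predicates, however, and any three
  of the four sets can be realised, with the prescribed sizes, in a domain with three elements.
  Hence reading each formula as a statement about the prescribed sizes makes all the rules sound,
  while some formulas are false.
\<close>

text \<open>
  Predicates 0, 1, 2 are the singletons; every other predicate is read as a copy of the
  two-element set.
\<close>

definition joint :: "nat \<Rightarrow> nat \<Rightarrow> int" where
  "joint p q = (if p \<ge> 3 \<and> q \<ge> 3 then 2 else if p = q \<or> p \<ge> 3 \<or> q \<ge> 3 then 1 else 0)"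

text \<open>Inclusion-exclusion in a domain of size 3, with \<open>joint\<close> as the intersection
  sizes.\<close>

fun pseudo_card :: "literal \<Rightarrow> literal \<Rightarrow> int" where
  "pseudo_card (Pos p) (Pos q) = joint p q"
| "pseudo_card (Pos p) (Neg q) = joint p p - joint p q"
| "pseudo_card (Neg p) (Pos q) = joint q q - joint p q"
| "pseudo_card (Neg p) (Neg q) = 3 - joint p p - joint q q + joint p q"

lemma opp_opp [simp]: "opp (opp L) = L"
  by (cases L) auto

lemma pseudo_card_commute: "pseudo_card L K = pseudo_card K L"
  by (cases L; cases K) (auto simp: joint_def)

lemma pseudo_card_nonneg: "pseudo_card L K \<ge> 0"
  by (cases L; cases K) (auto simp: joint_def)

lemma pseudo_card_opp_self: "pseudo_card L (opp L) = 0"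
  by (cases L) (auto simp: joint_def)

lemma pseudo_card_split: "pseudo_card L K + pseudo_card L (opp K) = pseudo_card L L"
  by (cases L; cases K) (auto simp: joint_def)

lemma joint_commute: "joint p q = joint q p"
  by (auto simp: joint_def)

text \<open>For genuine sets P, Q, R: P \<inter> Q and Q \<inter> R lie in Q and overlap inside P
  \<inter> R.\<close>

lemma joint_triangle: "joint p q + joint q r \<le> joint q q + joint p r"
  unfolding joint_def by (cases "p \<ge> 3"; cases "q \<ge> 3"; cases "r \<ge> 3") simp_all

text \<open>For genuine sets the left side is the size of the union minus that of the triple
  intersection. Three distinct singletons attain 3, which is why the domain has size 3.\<close>

lemma joint_perimeter:
  "joint p p + joint q q + joint r r - joint p q - joint q r - joint p r \<le> 3"
  unfolding joint_def by (cases "p \<ge> 3"; cases "q \<ge> 3"; cases "r \<ge> 3") simp_all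

text \<open>Mirrors the case split on K: L \<inter> M is covered by L \<inter> K and the part of M
  outside K. The eight sign patterns reduce to three instances of \<open>joint_triangle\<close> and
  one of \<open>joint_perimeter\<close>, each arising twice.\<close>

lemma pseudo_card_triangle:
  "pseudo_card L M \<le> pseudo_card L K + pseudo_card (opp K) M"
proof -
  have "?thesis" if "lit_pred L = p" "lit_pred K = q" "lit_pred M = r" for p q r
    using that joint_triangle[of p q r] joint_triangle[of q p r] joint_triangle[of p r q]
      joint_perimeter[of p q r] joint_commute[of q p] joint_commute[of r q]
    by (cases L; cases K; cases M) simp_all
  then show ?thesis by blast
qed

text \<open>Quantifying over both orderings of the pair avoids lifting \<open>pseudo_card\<close> to
  \<open>uprod\<close>; by symmetry the orderings agree.\<close>

fun pseudo_sat :: "formula \<Rightarrow> bool" where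
  "pseudo_sat (AtMost C M) \<longleftrightarrow> (\<forall>L K. M = Upair L K \<longrightarrow> pseudo_card L K \<le> C)"
| "pseudo_sat (AtLeast C M) \<longleftrightarrow> (\<forall>L K. M = Upair L K \<longrightarrow> C \<le> pseudo_card L K)"

lemma pseudo_sat_ex_le: "pseudo_sat (ex_le C L K) \<longleftrightarrow> pseudo_card L K \<le> C"
  by (auto simp: pseudo_card_commute)

lemma pseudo_sat_ex_ge: "pseudo_sat (ex_ge C L K) \<longleftrightarrow> C \<le> pseudo_card L K"
  by (auto simp: pseudo_card_commute)

lemmas pseudo_sat_iff = pseudo_sat_ex_le pseudo_sat_ex_ge

lemma deduces_pseudo_sat:
  assumes "\<Phi> \<turnstile>\<^sub>M \<phi>" and "\<forall>\<psi>\<in>\<Phi>. pseudo_sat \<psi>"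
  shows "pseudo_sat \<phi>"
  using assms(1)
proof induction
  case (premise \<phi>)
  then show ?case using assms(2) by blast
next
  case (axiom_ge L K)
  then show ?case unfolding pseudo_sat_iff by (rule pseudo_card_nonneg)
next
  case (axiom_le C L)
  then show ?case unfolding pseudo_sat_iff by (simp add: pseudo_card_opp_self)
next
  case (rule_le_le C L K D M)
  then show ?case
    using pseudo_card_triangle[of L M K] unfolding pseudo_sat_iff by linarith
next
  case (rule_ge_le C L K D M)
  then show ?case
    \<comment> \<open>Splitting on M: the part of L \<inter> K inside M has size at most D, so at
      least C - D remains outside M.\<close>
    using pseudo_card_triangle[of L K "opp M"] pseudo_card_commute[of M K]
    unfolding pseudo_sat_iff by simp
next
  case (rule_le_ge C L D K)
  then show ?case
    using pseudo_card_split[of L K] unfolding pseudo_sat_iff by linarith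
next
  case (ex_falso C L K D \<phi>)
  \<comment> \<open>Both bounds concern the same number, so D > C is impossible.\<close>
  then show ?case unfolding pseudo_sat_iff by linarith
qed

definition size_premises :: "nat \<Rightarrow> nat \<Rightarrow> nat \<Rightarrow> formula set" where
  "size_premises N m p =
    {ex_le (int m) (Pos p) (Pos p), ex_ge (int m) (Pos p) (Pos p),
     ex_le (int N - int m) (Neg p) (Neg p), ex_ge (int N - int m) (Neg p) (Neg p)}"

text \<open>The last two groups state that the singletons are pairwise disjoint and that each is
  contained in set 3.\<close>

definition pigeonhole_premises :: "formula set" where
  "pigeonhole_premises =
    (\<Union>p\<in>{0, 1, 2, 3}. size_premises 3 (if p = 3 then 2 else 1) p) \<union>
    {ex_le 0 (Pos 0) (Pos 1), ex_le 0 (Pos 0) (Pos 2), ex_le 0 (Pos 1) (Pos 2)} \<union>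
    {ex_le 0 (Pos 0) (Neg 3), ex_le 0 (Pos 1) (Neg 3), ex_le 0 (Pos 2) (Neg 3)}"

lemma pigeonhole_premises_N1plus: "pigeonhole_premises \<subseteq> N1plus"
  unfolding pigeonhole_premises_def size_premises_def N1plus_def by auto

lemma preds_pigeonhole_premises: "preds pigeonhole_premises = {0, 1, 2, 3}"
  unfolding preds_def pigeonhole_premises_def size_premises_def by auto

lemma numerically_explicit_pigeonhole_premises: "numerically_explicit pigeonhole_premises"
  unfolding numerically_explicit_def preds_pigeonhole_premises
proof (intro conjI exI ballI)
  fix p :: nat
  assume p: "p \<in> {0, 1, 2, 3}"
  let ?m = "if p = 3 then 2 else 1 :: nat"
  have "size_premises 3 ?m p \<subseteq> pigeonhole_premises"
    using p unfolding pigeonhole_premises_def by blast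
  then show "ex_le (int ?m) (Pos p) (Pos p) \<in> pigeonhole_premises"
    "ex_ge (int ?m) (Pos p) (Pos p) \<in> pigeonhole_premises"
    "ex_le (int 3 - int ?m) (Neg p) (Neg p) \<in> pigeonhole_premises"
    "ex_ge (int 3 - int ?m) (Neg p) (Neg p) \<in> pigeonhole_premises"
    unfolding size_premises_def by blast+
qed (use pigeonhole_premises_N1plus in auto)

lemma pseudo_sat_pigeonhole_premises: "\<forall>\<psi>\<in>pigeonhole_premises. pseudo_sat \<psi>"
  unfolding pigeonhole_premises_def size_premises_def
  \<comment> \<open>The defining equations would expose the quantifiers over orderings before
    \<open>pseudo_sat_iff\<close> applies.\<close>
  by (auto simp: pseudo_sat_iff joint_def simp del: pseudo_sat.simps)

lemma sat_ex_le_zeroD: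
  assumes "sat D I (ex_le 0 L K)" and "x \<in> D"
  shows "\<not> (lit_true I x L \<and> lit_true I x K)"
  using assms by (auto simp: ext_def)

lemma sat_ex_ge_oneD:
  assumes "sat D I (ex_ge 1 L L)"
  obtains x where "x \<in> D" "lit_true I x L"
proof -
  have "ext D I (Upair L L) \<noteq> {}"
    using assms by auto
  then show thesis
    using that by (auto simp: ext_def)
qed

lemma pigeonhole_premises_unsatisfiable:
  assumes sat: "\<forall>\<psi>\<in>pigeonhole_premises. sat D I \<psi>"
  shows False
proof -
  have "sat D I (ex_ge 1 (Pos p) (Pos p))" if "p \<in> {0, 1, 2}" for p
    using sat that unfolding pigeonhole_premises_def size_premises_def by auto
  then have "\<exists>x\<in>D. x \<in> I p" if "p \<in> {0, 1, 2}" for p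
    using that sat_ex_ge_oneD by (metis lit_true.simps(1))
  from this[of 0] this[of 1] this[of 2]
  obtain x y z where mem: "x \<in> D" "y \<in> D" "z \<in> D" "x \<in> I 0" "y \<in> I 1" "z \<in> I 2"
    by auto
  have "sat D I (ex_le 0 (Pos 0) (Pos 1))" "sat D I (ex_le 0 (Pos 0) (Pos 2))"
    "sat D I (ex_le 0 (Pos 1) (Pos 2))"
    using sat unfolding pigeonhole_premises_def by blast+
  from this[THEN sat_ex_le_zeroD] have distinct: "x \<noteq> y" "x \<noteq> z" "y \<noteq> z"
    using mem by auto
  have "sat D I (ex_le 0 (Pos 0) (Neg 3))" "sat D I (ex_le 0 (Pos 1) (Neg 3))"
    "sat D I (ex_le 0 (Pos 2) (Neg 3))"
    using sat unfolding pigeonhole_premises_def by blast+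
  from this[THEN sat_ex_le_zeroD] have sub: "{x, y, z} \<subseteq> ext D I (Upair (Pos 3) (Pos 3))"
    using mem by (auto simp: ext_def)
  have "ex_le 2 (Pos 3) (Pos 3) \<in> pigeonhole_premises"
    unfolding pigeonhole_premises_def size_premises_def by simp
  then have "sat D I (ex_le 2 (Pos 3) (Pos 3))"
    using sat by blast
  \<comment> \<open>The finiteness needed for \<open>card_mono\<close> is part of the meaning of
    \<open>AtMost\<close>.\<close>
  then have "card {x, y, z} \<le> 2"
    using card_mono[OF _ sub] by simp
  with distinct show False by simp
qed

theorem theorem16:
  "\<exists>(\<Phi> :: formula set) (\<phi> :: formula).
     finite \<Phi> \<and> \<Phi> \<subseteq> N1plus \<and> numerically_explicit \<Phi> \<and> \<phi> \<in> N1plus \<and>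
     \<Phi> \<TTurnstile> \<phi> \<and> \<not> \<Phi> \<turnstile>\<^sub>M \<phi>"
proof (intro exI conjI)
  \<comment> \<open>A contradiction: entailed vacuously by unsatisfiable premises, yet false under
    the pseudo-reading, where its pair has size 0.\<close>
  let ?\<phi> = "ex_ge 1 (Pos 0) (Neg 0)"
  show "finite pigeonhole_premises"
    unfolding pigeonhole_premises_def size_premises_def by simp
  show "?\<phi> \<in> N1plus"
    unfolding N1plus_def by force
  show "pigeonhole_premises \<TTurnstile> ?\<phi>"
    unfolding entails_def using pigeonhole_premises_unsatisfiable by blast
  have "\<not> pseudo_sat ?\<phi>"
    unfolding pseudo_sat_iff by simp
  then show "\<not> pigeonhole_premises \<turnstile>\<^sub>M ?\<phi>"
    using deduces_pseudo_sat pseudo_sat_pigeonhole_premises by blast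
qed (rule pigeonhole_premises_N1plus numerically_explicit_pigeonhole_premises)+

end
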